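(* The symmetric order satisfies $\bar r_{\mathrm{sym}}=4$.
   Context: The symmetric order $\bar r_{\mathrm{sym}}$ is the smallest positive integer $r$ such that the system consisting of the polynomial equations $$\sum_{\alpha_1,\alpha_2,\beta_1,\beta_2}\frac{1}{2^{\alpha_2+\beta_2}}\frac{2^{\beta_1}(-x_1)^{\alpha_1}x_2^{\beta_1}y_2^{\alpha_2}y_3^{\beta_2}}{\alpha_1!\alpha_2!\beta_1!\beta_2!}+\sum_{\alpha_1,\alpha_2}\frac{1}{2^{\alpha_2}}\frac{x_1^{\alpha_1}y_1^{\alpha_2}}{\alpha_1!\alpha_2!}=0,\qquad \ell=1,\dots,r,$$ together with the inequality $$|x_1|^r+|y_1|^{r/2}+|y_2|^{r/2}\le|2x_2-x_1|^r+|y_3-y_1|^{r/2}+|y_2+y_3|^{r/2},$$ has no non-trivial solution $(x_1,x_2,y_1,y_2,y_3)\in\mathbb R^5$. For each $\ell$, the first sum is over nonnegative integers $\alpha_1,\alpha_2,\beta_1,\beta_2$ with $\alpha_1+\beta_1+2\alpha_2+2\beta_2=\ell$, $1\le\alpha_1+\alpha_2\le r$ and $0\le\beta_1+\beta_2\le r-(\alpha_1+\alpha_2)$; the second sum is over nonnegative integers $\alpha_1,\alpha_2$ with $\alpha_1+2\alpha_2=\ell$ and $1\le\alpha_1+\alpha_2\le r$. A solution is non-trivial if at least one of $x_1,y_1,y_2$ is nonzero. (Convention $0^0=1$.) *)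

theory Defs
  imports Complex_Main
begin

definition first_indices :: "nat \<Rightarrow> nat \<Rightarrow> (nat \<times> nat \<times> nat \<times> nat) set" where
  "first_indices r l =
     {(a1, a2, b1, b2). a1 + b1 + 2 * a2 + 2 * b2 = l \<and>
        1 \<le> a1 + a2 \<and> a1 + a2 \<le> r \<and> b1 + b2 \<le> r - (a1 + a2)}"

definition second_indices :: "nat \<Rightarrow> nat \<Rightarrow> (nat \<times> nat) set" where
  "second_indices r l = {(a1, a2). a1 + 2 * a2 = l \<and> 1 \<le> a1 + a2 \<and> a1 + a2 \<le> r}"

lemma finite_first_indices: "finite (first_indices r l)"
  by (rule finite_subset[of _ "{..l} \<times> {..l} \<times> {..l} \<times> {..l}"])
    (auto simp: first_indices_def)

lemma finite_second_indices: "finite (second_indices r l)"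
  by (rule finite_subset[of _ "{..l} \<times> {..l}"]) (auto simp: second_indices_def)

definition order_poly ::
  "nat \<Rightarrow> nat \<Rightarrow> real \<Rightarrow> real \<Rightarrow> real \<Rightarrow> real \<Rightarrow> real \<Rightarrow> real" where
  "order_poly r l x1 x2 y1 y2 y3 =
     (\<Sum>(a1, a2, b1, b2) \<in> first_indices r l.
        1 / 2 ^ (a2 + b2) *
        (2 ^ b1 * (- x1) ^ a1 * x2 ^ b1 * y2 ^ a2 * y3 ^ b2 /
          (fact a1 * fact a2 * fact b1 * fact b2))) +
     (\<Sum>(a1, a2) \<in> second_indices r l.
        1 / 2 ^ a2 * (x1 ^ a1 * y1 ^ a2 / (fact a1 * fact a2)))"

text \<open>The exponent \<open>r / 2\<close> is a half-integer for odd \<open>r\<close>, hence \<open>powr\<close>;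
  only \<open>r > 0\<close> is relevant, where \<open>0 powr (r / 2) = 0\<close> is the intended value.\<close>

definition order_ineq ::
  "nat \<Rightarrow> real \<Rightarrow> real \<Rightarrow> real \<Rightarrow> real \<Rightarrow> real \<Rightarrow> bool" where
  "order_ineq r x1 x2 y1 y2 y3 \<longleftrightarrow>
     \<bar>x1\<bar> ^ r + \<bar>y1\<bar> powr (real r / 2) + \<bar>y2\<bar> powr (real r / 2)
     \<le> \<bar>2 * x2 - x1\<bar> ^ r + \<bar>y3 - y1\<bar> powr (real r / 2) + \<bar>y2 + y3\<bar> powr (real r / 2)"

definition order_solution ::
  "nat \<Rightarrow> real \<Rightarrow> real \<Rightarrow> real \<Rightarrow> real \<Rightarrow> real \<Rightarrow> bool" where
  "order_solution r x1 x2 y1 y2 y3 \<longleftrightarrow>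
     (\<forall>l\<in>{1..r}. order_poly r l x1 x2 y1 y2 y3 = 0) \<and> order_ineq r x1 x2 y1 y2 y3"

definition has_nontrivial_solution :: "nat \<Rightarrow> bool" where
  "has_nontrivial_solution r \<longleftrightarrow>
     (\<exists>x1 x2 y1 y2 y3. order_solution r x1 x2 y1 y2 y3 \<and> (x1 \<noteq> 0 \<or> y1 \<noteq> 0 \<or> y2 \<noteq> 0))"

text \<open>\<open>LEAST\<close> is unspecified when no such \<open>r\<close> exists, so statements about
  \<open>symmetric_order\<close> should be accompanied by existence.\<close>

definition symmetric_order :: nat where
  "symmetric_order = (LEAST r. 0 < r \<and> \<not> has_nontrivial_solution r)"

end

theory Submission
  imports Defs
begin

text \<open>Put \<open>u = 2 x\<^sub>2 - x\<^sub>1\<close> and \<open>U = y\<^sub>2 + y\<^sub>3\<close>. For \<open>\<ell> \<le> r\<close> the upper bounds \<open>r\<close> on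
  the index sums hold automatically, because the weight \<open>\<ell>\<close> dominates them. Hence the two sums
  are the coefficient of \<open>t\<^sup>\<ell>\<close> in
  \<open>exp (u t + U t\<^sup>2/2) - exp (2 x\<^sub>2 t + y\<^sub>3 t\<^sup>2/2) + exp (x\<^sub>1 t + y\<^sub>1 t\<^sup>2/2) - 1\<close>,
  a combination of Hermite-type polynomials (for example \<open>(p\<^sup>4 + 6 p\<^sup>2 q + 3 q\<^sup>2) / 24\<close> for
  \<open>\<ell> = 4\<close>), and they do not depend on \<open>r\<close>.

  For \<open>r \<le> 3\<close> take \<open>x\<^sub>1 = x\<^sub>2 = 0\<close>. The series are then even in \<open>t\<close>, so the only
  possible condition is \<open>y\<^sub>1 + y\<^sub>2 = 0\<close>, and a large \<open>y\<^sub>3\<close> makes the inequality true.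

  For \<open>r = 4\<close>, if \<open>u\<close> and \<open>x\<^sub>1\<close> are both nonzero, then the equations for \<open>\<ell> = 2\<close> and \<open>\<ell> = 3\<close>
  leave only \<open>m = y\<^sub>2 / x\<^sub>1\<close> free, and the one for \<open>\<ell> = 4\<close> becomes
  \<open>3 (m - u)\<^sup>2 + u\<^sup>2 + x\<^sub>1\<^sup>2 = 0\<close>, which is impossible over the reals. If \<open>u \<noteq> 0 = x\<^sub>1\<close>, the
  equations themselves force \<open>y\<^sub>1 = y\<^sub>2 = 0\<close>. If \<open>u = 0\<close>, the nontrivial solutions form the family
  \<open>y\<^sub>1 = y\<^sub>3 = - y\<^sub>2\<close> with \<open>x\<^sub>1\<close> arbitrary, on which the inequality reads
  \<open>x\<^sub>1\<^sup>4 + 2 y\<^sub>2\<^sup>2 \<le> 0\<close>.\<close>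

section \<open>The polynomials of low weight\<close>

lemma first_indices_explicit:
  shows "1 \<le> r \<Longrightarrow> first_indices r 1 = {(1,0,0,0)}"
    and "2 \<le> r \<Longrightarrow> first_indices r 2 = {(2,0,0,0), (1,0,1,0), (0,1,0,0)}"
    and "3 \<le> r \<Longrightarrow> first_indices r 3 =
      {(3,0,0,0), (2,0,1,0), (1,0,2,0), (1,1,0,0), (0,1,1,0), (1,0,0,1)}"
    and "4 \<le> r \<Longrightarrow> first_indices r 4 =
      {(4,0,0,0), (3,0,1,0), (2,0,2,0), (1,0,3,0), (2,1,0,0), (1,1,1,0), (0,1,2,0),
       (2,0,0,1), (1,0,1,1), (0,2,0,0), (0,1,0,1)}"
proof -
  have bounded: "a1 \<in> {0,1,2,3,4} \<and> a2 \<in> {0,1,2} \<and> b1 \<in> {0,1,2,3,4} \<and> b2 \<in> {0,1,2}"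
    if "(a1, a2, b1, b2) \<in> first_indices r l" "l \<le> 4" for r l a1 a2 b1 b2
  proof -
    have "a1 \<le> 4" "a2 \<le> 2" "b1 \<le> 4" "b2 \<le> 2"
      using that by (auto simp: first_indices_def)
    then show ?thesis
      by auto
  qed
  have eqI: "first_indices r l = S"
    if "l \<le> 4" and "S \<subseteq> first_indices r l"
      and "\<forall>a1\<in>{0,1,2,3,4}. \<forall>a2\<in>{0,1,2}. \<forall>b1\<in>{0,1,2,3,4}. \<forall>b2\<in>{0,1,2}.
        a1 + b1 + 2 * a2 + 2 * b2 = l \<and> 1 \<le> a1 + a2 \<longrightarrow> (a1, a2, b1, b2) \<in> S" for r l S
  proof (intro equalityI subsetI)
    fix p
    assume p: "p \<in> first_indices r l"
    obtain a1 a2 b1 b2 where "p = (a1, a2, b1, b2)"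
      by (cases p)
    then show "p \<in> S"
      using bounded[of a1 a2 b1 b2 r l] p that(1,3) unfolding first_indices_def by blast
  qed (use that(2) in auto)
  show "1 \<le> r \<Longrightarrow> first_indices r 1 = {(1,0,0,0)}"
    by (rule eqI) (auto simp: first_indices_def)
  show "2 \<le> r \<Longrightarrow> first_indices r 2 = {(2,0,0,0), (1,0,1,0), (0,1,0,0)}"
    by (rule eqI) (auto simp: first_indices_def)
  show "3 \<le> r \<Longrightarrow> first_indices r 3 =
      {(3,0,0,0), (2,0,1,0), (1,0,2,0), (1,1,0,0), (0,1,1,0), (1,0,0,1)}"
    by (rule eqI) (auto simp: first_indices_def)
  show "4 \<le> r \<Longrightarrow> first_indices r 4 =
      {(4,0,0,0), (3,0,1,0), (2,0,2,0), (1,0,3,0), (2,1,0,0), (1,1,1,0), (0,1,2,0),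
       (2,0,0,1), (1,0,1,1), (0,2,0,0), (0,1,0,1)}"
    by (rule eqI) (auto simp: first_indices_def)
qed

lemma second_indices_explicit:
  shows "1 \<le> r \<Longrightarrow> second_indices r 1 = {(1,0)}"
    and "2 \<le> r \<Longrightarrow> second_indices r 2 = {(2,0), (0,1)}"
    and "3 \<le> r \<Longrightarrow> second_indices r 3 = {(3,0), (1,1)}"
    and "4 \<le> r \<Longrightarrow> second_indices r 4 = {(4,0), (2,1), (0,2)}"
  unfolding second_indices_def by (auto; presburger)+

lemma order_poly_1:
  assumes "1 \<le> r"
  shows "order_poly r 1 x1 x2 y1 y2 y3 = 0"
  unfolding order_poly_def first_indices_explicit(1)[OF assms] second_indices_explicit(1)[OF assms]
  by simp

lemma order_poly_2:
  assumes "2 \<le> r"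
  shows "order_poly r 2 x1 x2 y1 y2 y3 = (y1 + y2) / 2 - x1 * (2 * x2 - x1)"
  unfolding order_poly_def first_indices_explicit(2)[OF assms] second_indices_explicit(2)[OF assms]
  by (simp add: field_simps power2_eq_square)

lemma order_poly_3:
  assumes "3 \<le> r"
  shows "order_poly r 3 x1 x2 y1 y2 y3 =
    ((2 * x2 - x1) * y2 + x1 * (y1 - y3) - 2 * x1 * x2 * (2 * x2 - x1)) / 2"
  unfolding order_poly_def first_indices_explicit(3)[OF assms] second_indices_explicit(3)[OF assms]
  by (simp add: field_simps eval_nat_numeral)

lemma order_poly_4:
  fixes x1 x2 y1 y2 y3 :: real
  defines "H \<equiv> \<lambda>p q :: real. p ^ 4 + 6 * p\<^sup>2 * q + 3 * q\<^sup>2"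
  assumes "4 \<le> r"
  shows "order_poly r 4 x1 x2 y1 y2 y3 =
    (H (2 * x2 - x1) (y2 + y3) - H (2 * x2) y3 + H x1 y1) / 24"
  unfolding order_poly_def H_def
    first_indices_explicit(4)[OF assms(2)] second_indices_explicit(4)[OF assms(2)]
  by (simp add: field_simps eval_nat_numeral)

section \<open>Orders one to three\<close>

text \<open>The value \<open>y\<^sub>3 = 5\<close> gives \<open>\<bar>y\<^sub>3 - y\<^sub>1\<bar> = \<bar>y\<^sub>2 + y\<^sub>3\<bar> = 4\<close>, which exceeds
  \<open>\<bar>y\<^sub>1\<bar> = \<bar>y\<^sub>2\<bar> = 1\<close>, so the inequality holds for every positive exponent \<open>r / 2\<close>.\<close>

lemma has_nontrivial_solution_below_4:
  assumes "0 < r" and "r < 4"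
  shows "has_nontrivial_solution r"
proof -
  have "order_poly r l 0 0 1 (-1) 5 = 0" if "l \<in> {1..r}" for l
  proof -
    have "l = 1 \<or> l = 2 \<or> l = 3"
      using that assms by auto
    then show ?thesis
      using that by (auto simp: order_poly_1[simplified] order_poly_2 order_poly_3)
  qed
  moreover have "order_ineq r 0 0 1 (-1) 5"
    using assms ge_one_powr_ge_zero[of 4 "real r / 2"] by (simp add: order_ineq_def)
  ultimately have "order_solution r 0 0 1 (-1) 5"
    by (simp add: order_solution_def)
  then show ?thesis
    unfolding has_nontrivial_solution_def by (metis zero_neq_one)
qed

section \<open>Order four\<close>

text \<open>Here \<open>x = x\<^sub>1\<close>, \<open>u = 2 x\<^sub>2 - x\<^sub>1\<close>, \<open>w = y\<^sub>2\<close> and \<open>v = y\<^sub>1 - y\<^sub>3\<close>. The equation of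
  weight two, \<open>y\<^sub>1 + y\<^sub>2 = 2 u x\<close>, expresses \<open>y\<^sub>1\<close> and \<open>y\<^sub>3\<close> through these. The first assumption is the equation of weight three, the second is that
  of weight four. If \<open>w = x m\<close> and \<open>v = u n\<close>, the first says \<open>m + n = u + x\<close>, and
  substituting for \<open>n\<close> in the second and dividing by \<open>u x\<close> gives
  \<open>3 (m - u)\<^sup>2 + u\<^sup>2 + x\<^sup>2 = 0\<close>.\<close>

lemma weight_three_four_imp_zero:
  fixes u x v w :: real
  assumes e3: "u * w + x * v = u * x * (u + x)"
    and e4: "3 * u\<^sup>2 * w + 3 * x\<^sup>2 * v + 6 * u * x * (w + v) - 3 * w * v
      - 2 * u ^ 3 * x - 9 * u\<^sup>2 * x\<^sup>2 - 2 * u * x ^ 3 = 0"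
  shows "u * x = 0"
proof (rule ccontr)
  assume "u * x \<noteq> 0"
  then have u: "u \<noteq> 0" and x: "x \<noteq> 0"
    by auto
  define m where "m = w / x"
  have w: "w = x * m"
    using x by (simp add: m_def)
  have "x * v = x * (u * (u + x - m))"
    using e3 unfolding w by (simp add: algebra_simps)
  then have v: "v = u * (u + x - m)"
    using x by simp
  have "u * x * (3 * (m - u)\<^sup>2 + u\<^sup>2 + x\<^sup>2) = 0"
    using e4 unfolding w v by (simp add: algebra_simps eval_nat_numeral)
  then have "3 * (m - u)\<^sup>2 + u\<^sup>2 + x\<^sup>2 = 0"
    using u x by simp
  moreover have "0 < u\<^sup>2" "0 \<le> x\<^sup>2" "0 \<le> (m - u)\<^sup>2"
    using u by auto
  ultimately show False
    by linarith
qed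

lemma abs_powr_four_half: "\<bar>a\<bar> powr (real 4 / 2) = a\<^sup>2"
  for a :: real
  by (cases "a = 0") (simp_all add: powr_numeral)

lemma no_nontrivial_solution_4: "\<not> has_nontrivial_solution 4"
proof
  assume "has_nontrivial_solution 4"
  then obtain x x2 y1 w z where sol: "order_solution 4 x x2 y1 w z"
    and nontriv: "x \<noteq> 0 \<or> y1 \<noteq> 0 \<or> w \<noteq> 0"
    unfolding has_nontrivial_solution_def by blast
  define u v where "u = 2 * x2 - x" and "v = y1 - z"
  have x2: "2 * x2 = u + x"
    by (simp add: u_def)
  have poly: "order_poly 4 l x x2 y1 w z = 0" if "l \<in> {1..4}" for l
    using sol that by (simp add: order_solution_def)
  have y1: "y1 = 2 * u * x - w"
    using poly[of 2] by (simp add: order_poly_2 u_def field_simps)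
  then have z: "z = 2 * u * x - w - v"
    by (simp add: v_def)
  have e3: "u * w + x * v = u * x * (u + x)"
    using poly[of 3] by (simp add: order_poly_3 u_def v_def algebra_simps)
  have "(u ^ 4 + 6 * u\<^sup>2 * (w + z) + 3 * (w + z)\<^sup>2)
      - ((u + x) ^ 4 + 6 * (u + x)\<^sup>2 * z + 3 * z\<^sup>2)
      + (x ^ 4 + 6 * x\<^sup>2 * y1 + 3 * y1\<^sup>2) = 0"
    using poly[of 4] by (simp add: order_poly_4 x2)
  then have e4: "3 * u\<^sup>2 * w + 3 * x\<^sup>2 * v + 6 * u * x * (w + v) - 3 * w * v
      - 2 * u ^ 3 * x - 9 * u\<^sup>2 * x\<^sup>2 - 2 * u * x ^ 3 = 0"
    unfolding z y1 by (simp add: algebra_simps eval_nat_numeral)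
  have ineq: "x ^ 4 + y1\<^sup>2 + w\<^sup>2 \<le> u ^ 4 + v\<^sup>2 + (w + z)\<^sup>2"
    using sol unfolding order_solution_def order_ineq_def abs_powr_four_half
    by (simp add: u_def v_def power2_commute[of z y1])
  have "x = 0 \<and> w = 0"
  proof (cases "u = 0")
    case u: True
    have "x * v = 0"
      using e3 u by simp
    then have "v = 0 \<or> x = 0 \<and> w = 0"
      using e4 u by auto
    then show ?thesis
    proof
      assume "v = 0"
      then have "x ^ 4 + 2 * w\<^sup>2 \<le> 0"
        using ineq u by (simp add: y1 z)
      moreover have "0 \<le> x ^ 4" "0 \<le> w\<^sup>2"
        by simp_all
      ultimately have "x ^ 4 = 0" "w\<^sup>2 = 0"
        by linarith+
      then show ?thesis
        by simp
    qed
  next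
    case u: False
    then have "x = 0"
      using weight_three_four_imp_zero[OF e3 e4] by simp
    then show ?thesis
      using e3 u by simp
  qed
  then show False
    using nontriv y1 by simp
qed

theorem proposition2p5:
  shows "(\<exists>r>0. \<not> has_nontrivial_solution r) \<and> symmetric_order = 4"
proof
  show "\<exists>r>0. \<not> has_nontrivial_solution r"
    using no_nontrivial_solution_4 by (intro exI[of _ 4]) simp
  show "symmetric_order = 4"
    unfolding symmetric_order_def
  proof (rule Least_equality)
    show "0 < (4::nat) \<and> \<not> has_nontrivial_solution 4"
      using no_nontrivial_solution_4 by simp
    show "4 \<le> r" if "0 < r \<and> \<not> has_nontrivial_solution r" for r
      using that has_nontrivial_solution_below_4[of r] by force
  qed
qed

end
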